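(* Let $\Omega$ and $\Gamma$ be finite sets, $n\ge2$, let $\{K_\gamma(\cdot\mid\cdot)\}_{\gamma\in\Gamma}$ be a collection of Markov transition kernels on $\Omega$, and for $1\le i<n$, $x\in\Omega$, $\gamma'\in\Gamma$ let $g_i(\cdot\mid x,\gamma')$ be a probability measure on $\Gamma$. Let $p_0$ be a probability distribution on $\Omega\times\Gamma$, and let $\mu$ be the adaptive Markov measure on $\Omega^n$ defined by $$\mu(x)=\sum_{(\gamma_1,\ldots,\gamma_n)\in\Gamma^n}p_0(x_1,\gamma_1)\prod_{i=1}^{n-1}\big[g_i(\gamma_{i+1}\mid x_i,\gamma_i)\,K_{\gamma_i}(x_{i+1}\mid x_i)\big],\qquad x\in\Omega^n .$$ Define $$\kappa=\max_{w,w'\in\Omega,\ \gamma,\gamma'\in\Gamma}\|K_\gamma(\cdot\mid w)-K_{\gamma'}(\cdot\mid w')\|_{TV},\qquad \lambda_i=\max_{w,w'\in\Omega,\ \gamma,\gamma'\in\Gamma}\|g_i(\cdot\mid w,\gamma)-g_i(\cdot\mid w',\gamma')\|_{TV}.$$ Then the $\eta$-mixing coefficients of $\mu$ satisfy, for all $1\le i<j\le n$, $$\bar\eta_{ij}\;\le\;\theta_i\theta_{i+1}\cdots\theta_{j-1},\qquad\text{where }\ \theta_i=\kappa+\lambda_i-\kappa\lambda_i .$$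
   Context: $\|\tau\|_{TV}=\frac12[\sup_A\tau(A)-\inf_A\tau(A)]$ for a signed measure $\tau$. $\eta$-mixing coefficients of a probability measure $\mu$ on $\Omega^n$: let $X=(X_1,\ldots,X_n)$ have law $\mu$ and write $X_{j:n}=(X_j,\ldots,X_n)$. For $1\le i<j\le n$, $$\bar\eta_{ij}=\max_{y\in\Omega^{i-1},\ w,w'\in\Omega}\big\|\mathcal{L}(X_{j:n}\mid X_{1:i}=(y,w))-\mathcal{L}(X_{j:n}\mid X_{1:i}=(y,w'))\big\|_{TV},$$ where $\mathcal{L}(\cdot\mid\cdot)$ denotes conditional law and the maximum is over those $y,w,w'$ for which both conditioning events have positive probability. *)

theory Defs
  imports "HOL-Probability.Probability"
begin

text \<open>
  A measure on \<open>\<Omega>\<^sup>n\<close>, for a finite set \<open>\<Omega>\<close>, is a pmf on lists over a finite type that is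
  supported on the lists of length \<open>n\<close>. The coordinate \<open>x\<^sub>i\<close>, \<open>1 \<le> i \<le> n\<close>, is \<open>xs ! (i - 1)\<close>,
  so \<open>X\<^bsub>1:i\<^esub>\<close> is \<open>take i\<close> and \<open>X\<^bsub>j:n\<^esub>\<close> is \<open>drop (j - 1)\<close>.
\<close>

text \<open>
  A signed measure is given by its set function; all measures here are discrete, so every set
  is measurable.
\<close>

definition tv_norm :: "('c set \<Rightarrow> real) \<Rightarrow> real" where
  "tv_norm \<tau> = 1 / 2 * ((SUP A. \<tau> A) - (INF A. \<tau> A))"

definition tv_diff :: "'c pmf \<Rightarrow> 'c pmf \<Rightarrow> real" where
  "tv_diff p q = tv_norm (\<lambda>A. measure_pmf.prob p A - measure_pmf.prob q A)"

definition prefix_event :: "nat \<Rightarrow> 'a list \<Rightarrow> 'a list set" where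
  "prefix_event i z = {x. take i x = z}"

definition cond_law :: "'a list pmf \<Rightarrow> nat \<Rightarrow> nat \<Rightarrow> 'a list \<Rightarrow> 'a list pmf" where
  "cond_law \<mu> i j z = map_pmf (drop (j - 1)) (cond_pmf \<mu> (prefix_event i z))"

definition eta_bar :: "'a::finite list pmf \<Rightarrow> nat \<Rightarrow> nat \<Rightarrow> real" where
  "eta_bar \<mu> i j =
     Max {tv_diff (cond_law \<mu> i j (y @ [w])) (cond_law \<mu> i j (y @ [w'])) | y w w'.
            length y = i - 1 \<and>
            measure_pmf.prob \<mu> (prefix_event i (y @ [w])) > 0 \<and>
            measure_pmf.prob \<mu> (prefix_event i (y @ [w'])) > 0}"

definition path_weight ::
  "nat \<Rightarrow> ('a \<times> 'b) pmf \<Rightarrow> ('b \<Rightarrow> 'a \<Rightarrow> 'a pmf) \<Rightarrow> (nat \<Rightarrow> 'a \<Rightarrow> 'b \<Rightarrow> 'b pmf) \<Rightarrow>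
     'a list \<Rightarrow> 'b list \<Rightarrow> real" where
  "path_weight n p0 K g xs gs =
     pmf p0 (xs ! 0, gs ! 0) *
     (\<Prod>i = 1..<n. pmf (g i (xs ! (i - 1)) (gs ! (i - 1))) (gs ! i) *
                 pmf (K (gs ! (i - 1)) (xs ! (i - 1))) (xs ! i))"

text \<open>
  \<open>embed_pmf\<close> is only meaningful for mass functions of total mass \<open>1\<close>; this is verified for
  \<open>n \<ge> 1\<close> in \<open>pmf_adaptive_markov\<close> below.
\<close>

definition adaptive_markov ::
  "nat \<Rightarrow> ('a::finite \<times> 'b::finite) pmf \<Rightarrow> ('b \<Rightarrow> 'a \<Rightarrow> 'a pmf) \<Rightarrow>
     (nat \<Rightarrow> 'a \<Rightarrow> 'b \<Rightarrow> 'b pmf) \<Rightarrow> 'a list pmf" where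
  "adaptive_markov n p0 K g = embed_pmf
     (\<lambda>xs. if length xs = n then \<Sum>gs | length gs = n. path_weight n p0 K g xs gs else 0)"

definition kappa :: "('b::finite \<Rightarrow> 'a::finite \<Rightarrow> 'a pmf) \<Rightarrow> real" where
  "kappa K = Max {tv_diff (K \<gamma> w) (K \<gamma>' w') | w w' \<gamma> \<gamma>'. True}"

definition lam :: "(nat \<Rightarrow> 'a::finite \<Rightarrow> 'b::finite \<Rightarrow> 'b pmf) \<Rightarrow> nat \<Rightarrow> real" where
  "lam g i = Max {tv_diff (g i w \<gamma>) (g i w' \<gamma>') | w w' \<gamma> \<gamma>'. True}"

definition theta ::
  "('b::finite \<Rightarrow> 'a::finite \<Rightarrow> 'a pmf) \<Rightarrow> (nat \<Rightarrow> 'a \<Rightarrow> 'b \<Rightarrow> 'b pmf) \<Rightarrow> nat \<Rightarrow> real" where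
  "theta K g i = kappa K + lam g i - kappa K * lam g i"

lemma finite_lists_of_length: "finite {xs :: 'a::finite list. length xs = n}"
  using finite_lists_length_eq[of "UNIV :: 'a set" n] by simp

lemma sum_lists_Suc:
  fixes f :: "'a::finite list \<Rightarrow> real"
  shows "(\<Sum>xs | length xs = Suc n. f xs) = (\<Sum>xs | length xs = n. \<Sum>x\<in>UNIV. f (xs @ [x]))"
proof -
  have "(\<Sum>xs | length xs = Suc n. f xs) =
        (\<Sum>(xs, x)\<in>{xs. length xs = n} \<times> UNIV. f (xs @ [x]))"
    by (rule sum.reindex_bij_witness[of _ "\<lambda>(xs, x). xs @ [x]" "\<lambda>xs. (butlast xs, last xs)"])
       (auto simp: length_Suc_conv_rev)
  then show ?thesis
    by (simp add: sum.cartesian_product)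
qed

lemma path_weight_snoc:
  assumes "n \<ge> 1" "length xs = n" "length gs = n"
  shows "path_weight (Suc n) p0 K g (xs @ [x]) (gs @ [c]) =
         path_weight n p0 K g xs gs * (pmf (g n (last xs) (last gs)) c * pmf (K (last gs) (last xs)) x)"
proof -
  have ne: "xs \<noteq> []" "gs \<noteq> []" using assms by auto
  have "(\<Prod>i = 1..<n. pmf (g i ((xs @ [x]) ! (i - 1)) ((gs @ [c]) ! (i - 1))) ((gs @ [c]) ! i) *
            pmf (K ((gs @ [c]) ! (i - 1)) ((xs @ [x]) ! (i - 1))) ((xs @ [x]) ! i)) =
        (\<Prod>i = 1..<n. pmf (g i (xs ! (i - 1)) (gs ! (i - 1))) (gs ! i) *
            pmf (K (gs ! (i - 1)) (xs ! (i - 1))) (xs ! i))"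
    using assms by (intro prod.cong) (auto simp: nth_append)
  then show ?thesis
    using assms ne
    by (simp add: path_weight_def prod.atLeastLessThan_Suc nth_append last_conv_nth)
qed

lemma sum_pmf_UNIV: "(\<Sum>x\<in>UNIV. pmf p (x :: 'a::finite)) = 1"
  by (rule sum_pmf_eq_1) auto

lemma sum_path_weight:
  fixes p0 :: "('a::finite \<times> 'b::finite) pmf"
  assumes "n \<ge> 1"
  shows "(\<Sum>xs | length xs = n. \<Sum>gs | length gs = n. path_weight n p0 K g xs gs) = 1"
  using assms
proof (induction n rule: dec_induct)
  case base
  have "(\<Sum>x\<in>UNIV. \<Sum>c\<in>UNIV. pmf p0 (x, c)) = (\<Sum>z\<in>UNIV. pmf p0 z)"
    by (simp add: sum.cartesian_product)
  then show ?case
    by (simp add: sum_lists_Suc path_weight_def sum_pmf_UNIV)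
next
  case (step n)
  have "(\<Sum>xs | length xs = Suc n. \<Sum>gs | length gs = Suc n. path_weight (Suc n) p0 K g xs gs) =
    (\<Sum>xs | length xs = n. \<Sum>x\<in>UNIV. \<Sum>gs | length gs = n. \<Sum>c\<in>UNIV.
       path_weight (Suc n) p0 K g (xs @ [x]) (gs @ [c]))"
    by (simp add: sum_lists_Suc)
  also have "\<dots> = (\<Sum>xs | length xs = n. \<Sum>gs | length gs = n. \<Sum>x\<in>UNIV. \<Sum>c\<in>UNIV.
       path_weight (Suc n) p0 K g (xs @ [x]) (gs @ [c]))"
    by (intro sum.cong refl sum.swap)
  also have "\<dots> = (\<Sum>xs | length xs = n. \<Sum>gs | length gs = n. path_weight n p0 K g xs gs)"
  proof (intro sum.cong refl)
    fix xs :: "'a list" and gs :: "'b list"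
    assume "xs \<in> {xs. length xs = n}" "gs \<in> {gs. length gs = n}"
    then have "(\<Sum>x\<in>UNIV. \<Sum>c\<in>UNIV. path_weight (Suc n) p0 K g (xs @ [x]) (gs @ [c])) =
      (\<Sum>x\<in>UNIV. \<Sum>c\<in>UNIV. path_weight n p0 K g xs gs *
         (pmf (g n (last xs) (last gs)) c * pmf (K (last gs) (last xs)) x))"
      using step.hyps by (intro sum.cong refl path_weight_snoc) auto
    also have "\<dots> = path_weight n p0 K g xs gs"
      by (simp flip: sum_distrib_left sum_distrib_right add: sum_pmf_UNIV)
    finally show "(\<Sum>x\<in>UNIV. \<Sum>c\<in>UNIV. path_weight (Suc n) p0 K g (xs @ [x]) (gs @ [c])) =
      path_weight n p0 K g xs gs" .
  qed
  finally show ?case using step.IH by simp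
qed

lemma path_weight_nonneg: "path_weight n p0 K g xs gs \<ge> 0"
  unfolding path_weight_def by (intro mult_nonneg_nonneg prod_nonneg) auto

lemma pmf_adaptive_markov:
  assumes "n \<ge> 1"
  shows "pmf (adaptive_markov n p0 K g) xs =
    (if length xs = n then \<Sum>gs | length gs = n. path_weight n p0 K g xs gs else 0)"
proof -
  define f where "f = (\<lambda>xs. if length xs = n
    then \<Sum>gs | length gs = n. path_weight n p0 K g xs gs else 0)"
  have nonneg: "f ys \<ge> 0" for ys
    unfolding f_def by (auto intro!: sum_nonneg path_weight_nonneg)
  have "(\<integral>\<^sup>+ ys. ennreal (f ys) \<partial>count_space UNIV) = (\<Sum>ys | length ys = n. ennreal (f ys))"
    by (rule nn_integral_count_space'[OF finite_lists_of_length]) (auto simp: f_def)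
  also have "\<dots> = ennreal (\<Sum>ys | length ys = n. f ys)"
    using nonneg by (intro sum_ennreal) auto
  also have "(\<Sum>ys | length ys = n. f ys) = 1"
    using sum_path_weight[OF assms, of p0 K g] by (simp add: f_def)
  finally have "pmf (embed_pmf f) xs = f xs"
    using nonneg by (intro pmf_embed_pmf) auto
  then show ?thesis
    by (simp add: adaptive_markov_def f_def)
qed

end

theory Submission
  imports Defs
begin

text \<open>
  The pairs \<open>(X\<^sub>k, \<gamma>\<^sub>k)\<close> form a Markov chain whose \<open>k\<close>-th transition law is the product
  \<open>K\<^sub>\<gamma>(\<cdot> | x) \<otimes> g\<^sub>k(\<cdot> | x, \<gamma>)\<close>, and \<open>\<mu>\<close> is the law of its first coordinates. Two such product laws
  share a common part of mass at least \<open>(1 - \<kappa>) (1 - \<lambda>\<^sub>k) = 1 - \<theta>\<^sub>k\<close>, so averaging a function over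
  the \<open>k\<close>-th transition shrinks its oscillation by the factor \<open>\<theta>\<^sub>k\<close>. Given the state at time \<open>i\<close>, the
  probability that \<open>X\<^bsub>j:n\<^esub>\<close> lies in \<open>A\<close> arises from a function with values in \<open>[0, 1]\<close> by averaging
  over the transitions \<open>i, \<dots>, j - 1\<close>; it therefore oscillates by at most
  \<open>\<theta>\<^sub>i \<cdots> \<theta>\<^bsub>j-1\<^esub>\<close>. The two conditional probabilities of this event that enter \<open>\<eta>\<^bsub>ij\<^esub>\<close> are averages
  of that one function over the hidden state \<open>\<gamma>\<^sub>i\<close>.
\<close>

section \<open>Total variation distance\<close>

lemma prob_diff_bounds:
  "measure_pmf.prob p A - measure_pmf.prob q A \<le> 1"
  "- 1 \<le> measure_pmf.prob p A - measure_pmf.prob q A"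
  using measure_pmf.prob_le_1[of p A] measure_pmf.prob_le_1[of q A]
    measure_nonneg[of p A] measure_nonneg[of q A] by linarith+

text \<open>Passing to the complement of \<open>A\<close> flips the sign of the difference, so the
  supremum and the negated infimum are both at least the value at \<open>A\<close>, and hence so is
  half their sum.\<close>

lemma prob_diff_le_tv_diff:
  "measure_pmf.prob p A - measure_pmf.prob q A \<le> tv_diff p q"
proof -
  let ?\<tau> = "\<lambda>A. measure_pmf.prob p A - measure_pmf.prob q A"
  have "?\<tau> A \<le> (SUP A. ?\<tau> A)"
    by (rule cSUP_upper) (auto intro!: bdd_aboveI[of _ 1] prob_diff_bounds)
  moreover have "(INF A. ?\<tau> A) \<le> ?\<tau> (- A)"
    by (rule cINF_lower) (auto intro!: bdd_belowI[of _ "- 1"] prob_diff_bounds)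
  moreover have "?\<tau> (- A) = - ?\<tau> A"
    using measure_pmf.prob_compl[of A p] measure_pmf.prob_compl[of A q]
    by (simp add: Compl_eq_Diff_UNIV)
  ultimately show ?thesis
    by (simp add: tv_diff_def tv_norm_def)
qed

lemma tv_diff_le:
  assumes "\<And>A. \<bar>measure_pmf.prob p A - measure_pmf.prob q A\<bar> \<le> D"
  shows "tv_diff p q \<le> D"
proof -
  let ?\<tau> = "\<lambda>A. measure_pmf.prob p A - measure_pmf.prob q A"
  have "?\<tau> A \<le> D" "- D \<le> ?\<tau> A" for A
    using assms[of A] by linarith+
  then have "(SUP A. ?\<tau> A) \<le> D" "- D \<le> (INF A. ?\<tau> A)"
    by (auto intro: cSUP_least cINF_greatest)
  then show ?thesis
    by (simp add: tv_diff_def tv_norm_def)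
qed

lemma tv_diff_le_1: "tv_diff p q \<le> 1"
proof (rule tv_diff_le)
  fix A
  show "\<bar>measure_pmf.prob p A - measure_pmf.prob q A\<bar> \<le> 1"
    using prob_diff_bounds[of p A q] by linarith
qed

text \<open>The overlap falls short of 1 by exactly the excess of \<open>p\<close> over
  \<open>q\<close> on the set where \<open>p\<close> is larger, and that excess is at most the total
  variation distance.\<close>

lemma sum_min_pmf_ge:
  fixes p q :: "'c::finite pmf"
  shows "1 - tv_diff p q \<le> (\<Sum>x\<in>UNIV. min (pmf p x) (pmf q x))"
proof -
  let ?A = "{x. pmf q x < pmf p x}"
  have "(\<Sum>x\<in>UNIV. min (pmf p x) (pmf q x)) =
    (\<Sum>x\<in>UNIV. pmf p x - (if x \<in> ?A then pmf p x - pmf q x else 0))"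
    by (intro sum.cong) auto
  also have "\<dots> = 1 - (\<Sum>x\<in>?A. pmf p x - pmf q x)"
    by (simp add: sum_subtractf sum_pmf_UNIV sum.If_cases)
  also have "(\<Sum>x\<in>?A. pmf p x - pmf q x) = measure_pmf.prob p ?A - measure_pmf.prob q ?A"
    by (simp add: sum_subtractf measure_measure_pmf_finite)
  finally show ?thesis
    using prob_diff_le_tv_diff[of p ?A q] by linarith
qed

section \<open>Bounds on \<kappa> and \<lambda>\<close>

lemma kappa_eq_Max_image:
  fixes K :: "'b::finite \<Rightarrow> 'a::finite \<Rightarrow> 'a pmf"
  shows "kappa K = Max (range (\<lambda>(w, w', \<gamma>, \<gamma>'). tv_diff (K \<gamma> w) (K \<gamma>' w')))"
  unfolding kappa_def by (intro arg_cong[where f = Max]) (force simp: image_iff)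

lemma tv_diff_le_kappa:
  fixes K :: "'b::finite \<Rightarrow> 'a::finite \<Rightarrow> 'a pmf"
  shows "tv_diff (K \<gamma> w) (K \<gamma>' w') \<le> kappa K"
  unfolding kappa_eq_Max_image by (intro Max_ge image_eqI[of _ _ "(w, w', \<gamma>, \<gamma>')"]) auto

lemma kappa_le_1:
  fixes K :: "'b::finite \<Rightarrow> 'a::finite \<Rightarrow> 'a pmf"
  shows "kappa K \<le> 1"
  unfolding kappa_eq_Max_image by (intro Max.boundedI) (auto simp: tv_diff_le_1)

text \<open>\<open>g i\<close> has the type of \<open>K\<close> with states and parameters
  exchanged, so facts about \<open>kappa\<close> carry over to \<open>lam\<close>.\<close>

lemma lam_eq_kappa: "lam g i = kappa (\<lambda>w \<gamma>. g i w \<gamma>)"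
  unfolding lam_def kappa_def by (intro arg_cong[where f = Max]) blast

lemma tv_diff_le_lam:
  fixes g :: "nat \<Rightarrow> 'a::finite \<Rightarrow> 'b::finite \<Rightarrow> 'b pmf"
  shows "tv_diff (g i w \<gamma>) (g i w' \<gamma>') \<le> lam g i"
  unfolding lam_eq_kappa by (rule tv_diff_le_kappa)

lemma lam_le_1:
  fixes g :: "nat \<Rightarrow> 'a::finite \<Rightarrow> 'b::finite \<Rightarrow> 'b pmf"
  shows "lam g i \<le> 1"
  unfolding lam_eq_kappa by (rule kappa_le_1)

lemma theta_alt: "theta K g k = 1 - (1 - kappa K) * (1 - lam g k)"
  by (simp add: theta_def algebra_simps)

section \<open>Contraction of oscillations\<close>

text \<open>The common part \<open>w\<close> cancels. What remains of \<open>P\<close> has mass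
  \<open>1 - sum w UNIV\<close> and contributes at most \<open>D\<close> per unit of mass; what
  remains of \<open>Q\<close> contributes a nonnegative amount.\<close>

lemma expectation_diff_le_overlap:
  fixes P Q :: "'c::finite pmf" and f :: "'c \<Rightarrow> real"
  assumes w: "\<And>x. w x \<le> pmf P x" "\<And>x. w x \<le> pmf Q x"
    and f: "\<And>x. 0 \<le> f x" "\<And>x. f x \<le> D"
  shows "measure_pmf.expectation P f - measure_pmf.expectation Q f \<le> D * (1 - sum w UNIV)"
proof -
  have "(\<Sum>x\<in>UNIV. f x * (pmf P x - w x)) \<le> (\<Sum>x\<in>UNIV. D * (pmf P x - w x))"
    using w f by (intro sum_mono mult_right_mono) auto
  also have "\<dots> = D * (1 - sum w UNIV)"
    by (simp add: sum_subtractf sum_pmf_UNIV flip: sum_distrib_left)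
  finally have 1: "(\<Sum>x\<in>UNIV. f x * pmf P x) - (\<Sum>x\<in>UNIV. f x * w x) \<le> D * (1 - sum w UNIV)"
    by (simp add: right_diff_distrib sum_subtractf)
  have 2: "(\<Sum>x\<in>UNIV. f x * w x) \<le> (\<Sum>x\<in>UNIV. f x * pmf Q x)"
    using w f by (intro sum_mono mult_left_mono) auto
  show ?thesis
    using 1 2 by (simp add: integral_measure_pmf_real[of UNIV])
qed

text \<open>The product of the two marginal overlaps lies below both product laws, so it serves as
  their common part.\<close>

lemma expectation_pair_pmf_diff_le:
  fixes p p' :: "'a::finite pmf" and q q' :: "'b::finite pmf" and f :: "'a \<times> 'b \<Rightarrow> real"
  assumes k: "tv_diff p p' \<le> k" "k \<le> 1" and l: "tv_diff q q' \<le> l" "l \<le> 1"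
    and osc: "\<And>s t. f s - f t \<le> D"
  shows "measure_pmf.expectation (pair_pmf p q) f - measure_pmf.expectation (pair_pmf p' q') f
    \<le> (1 - (1 - k) * (1 - l)) * D"
proof -
  define m where "m x = min (pmf p x) (pmf p' x)" for x
  define m' where "m' y = min (pmf q y) (pmf q' y)" for y
  define w where "w = (\<lambda>(x, y). m x * m' y)"
  \<comment> \<open>Shifting \<open>f\<close> by its minimum puts its values in
    \<open>[0, D]\<close> and leaves differences of expectations unchanged.\<close>
  define a where "a = Min (range f)"
  have a: "a \<le> f s" "f s - a \<le> D" for s
  proof -
    have "a \<in> range f" unfolding a_def by (intro Min_in) auto
    then show "f s - a \<le> D" using osc by blast
  qed (simp add: a_def)
  have "0 \<le> D"
    using osc[of undefined undefined] by simp
  have expect: "measure_pmf.expectation P (\<lambda>s. f s - a) = measure_pmf.expectation P f - a"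
    for P :: "('a \<times> 'b) pmf"
    by (simp add: integrable_measure_pmf_finite)
  have nonneg: "0 \<le> m x" "0 \<le> m' y" for x y
    by (simp_all add: m_def m'_def)
  have wle: "w s \<le> pmf (pair_pmf p q) s" "w s \<le> pmf (pair_pmf p' q') s" for s
    by (cases s; auto simp: w_def m_def m'_def pmf_pair intro!: mult_mono)+
  have "(1 - k) * (1 - l) \<le> sum m UNIV * sum m' UNIV"
    using sum_min_pmf_ge[of p p'] sum_min_pmf_ge[of q q'] k l nonneg
    by (intro mult_mono) (auto simp: m_def m'_def intro!: sum_nonneg)
  also have "\<dots> = sum w UNIV"
    by (simp add: sum_product sum.cartesian_product w_def)
  finally have "D * (1 - sum w UNIV) \<le> D * (1 - (1 - k) * (1 - l))"
    using \<open>0 \<le> D\<close> by (intro mult_left_mono) auto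
  moreover have "measure_pmf.expectation (pair_pmf p q) (\<lambda>s. f s - a)
      - measure_pmf.expectation (pair_pmf p' q') (\<lambda>s. f s - a) \<le> D * (1 - sum w UNIV)"
    by (rule expectation_diff_le_overlap[OF wle]) (use a in auto)
  ultimately show ?thesis
    by (simp add: expect mult.commute)
qed

section \<open>The joint chain\<close>

text \<open>Both kernels read only the current state: the next point is drawn with the old
  parameter, so the two new coordinates are conditionally independent.\<close>

definition joint_step ::
  "('b \<Rightarrow> 'a \<Rightarrow> 'a pmf) \<Rightarrow> (nat \<Rightarrow> 'a \<Rightarrow> 'b \<Rightarrow> 'b pmf) \<Rightarrow> nat \<Rightarrow> 'a \<times> 'b \<Rightarrow> ('a \<times> 'b) pmf" where
  "joint_step K g k s = pair_pmf (K (snd s) (fst s)) (g k (fst s) (snd s))"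

text \<open>The states at times \<open>k + 1, \<dots>, k + m\<close>, given the state at time \<open>k\<close>.\<close>

primrec future ::
  "('b \<Rightarrow> 'a \<Rightarrow> 'a pmf) \<Rightarrow> (nat \<Rightarrow> 'a \<Rightarrow> 'b \<Rightarrow> 'b pmf) \<Rightarrow> nat \<Rightarrow> nat \<Rightarrow> 'a \<times> 'b \<Rightarrow> ('a \<times> 'b) list pmf"
where
  "future K g 0 k s = return_pmf []"
| "future K g (Suc m) k s =
     bind_pmf (joint_step K g k s) (\<lambda>t. map_pmf ((#) t) (future K g m (Suc k) t))"

text \<open>The states at times \<open>1, \<dots>, m + 1\<close>.\<close>

definition joint_chain ::
  "('a \<times> 'b) pmf \<Rightarrow> ('b \<Rightarrow> 'a \<Rightarrow> 'a pmf) \<Rightarrow> (nat \<Rightarrow> 'a \<Rightarrow> 'b \<Rightarrow> 'b pmf) \<Rightarrow> nat \<Rightarrow>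
     ('a \<times> 'b) list pmf" where
  "joint_chain p0 K g m = bind_pmf p0 (\<lambda>s. map_pmf ((#) s) (future K g m 1 s))"

lemma expectation_joint_step_diff_le:
  fixes K :: "'b::finite \<Rightarrow> 'a::finite \<Rightarrow> 'a pmf"
  assumes "\<And>s t. f s - f t \<le> D"
  shows "measure_pmf.expectation (joint_step K g k s) f
    - measure_pmf.expectation (joint_step K g k t) f \<le> theta K g k * D"
  unfolding joint_step_def theta_alt
  by (intro expectation_pair_pmf_diff_le tv_diff_le_kappa tv_diff_le_lam kappa_le_1 lam_le_1 assms)

lemma prob_bind_pmf:
  "measure_pmf.prob (bind_pmf p F) A =
   measure_pmf.expectation p (\<lambda>x. measure_pmf.prob (F x) A)"
proof -
  \<comment> \<open>Rewriting an event as the point \<open>True\<close> of a pushforward reduces the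
    claim to \<open>pmf_bind\<close>.\<close>
  have prob: "measure_pmf.prob q A = pmf (map_pmf (\<lambda>x. x \<in> A) q) True" for q
    by (simp add: pmf_map vimage_def)
  show ?thesis
    unfolding prob by (simp add: map_bind_pmf pmf_bind)
qed

lemma prob_future_Suc:
  "measure_pmf.prob (future K g (Suc m) k s) A =
   measure_pmf.expectation (joint_step K g k s)
     (\<lambda>t. measure_pmf.prob (future K g m (Suc k) t) ((#) t -` A))"
  by (simp add: prob_bind_pmf)

text \<open>Induction on \<open>d\<close>, peeling off the first transition. The event ignores the
  first \<open>d\<close> new states, so \<open>d + 1\<close> transitions contract before it is read;
  at \<open>d = 0\<close> probabilities in \<open>[0, 1]\<close> oscillate by at most 1.\<close>

lemma future_event_oscillation:
  fixes K :: "'b::finite \<Rightarrow> 'a::finite \<Rightarrow> 'a pmf"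
  assumes "d < m"
  shows "measure_pmf.prob (future K g m k s) {r. drop d (map fst r) \<in> A}
    - measure_pmf.prob (future K g m k t) {r. drop d (map fst r) \<in> A}
    \<le> (\<Prod>l = k..k + d. theta K g l)"
  using assms
proof (induction d arbitrary: m k s t)
  case 0
  then obtain m' where m: "m = Suc m'"
    by (cases m) auto
  have "measure_pmf.prob (future K g m k s) {r. drop 0 (map fst r) \<in> A}
    - measure_pmf.prob (future K g m k t) {r. drop 0 (map fst r) \<in> A} \<le> theta K g k * 1"
    unfolding m prob_future_Suc
  proof (rule expectation_joint_step_diff_le)
    fix s t :: "'a \<times> 'b"
    show "measure_pmf.prob (future K g m' (Suc k) s) ((#) s -` {r. drop 0 (map fst r) \<in> A})
      - measure_pmf.prob (future K g m' (Suc k) t) ((#) t -` {r. drop 0 (map fst r) \<in> A}) \<le> 1"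
      by (smt (verit) measure_nonneg measure_pmf.prob_le_1)
  qed
  then show ?case by simp
next
  case (Suc d)
  then obtain m' where m: "m = Suc m'" "d < m'"
    by (cases m) auto
  have "measure_pmf.prob (future K g m k s) {r. drop (Suc d) (map fst r) \<in> A}
    - measure_pmf.prob (future K g m k t) {r. drop (Suc d) (map fst r) \<in> A}
    \<le> theta K g k * (\<Prod>l = Suc k..Suc k + d. theta K g l)"
    unfolding m prob_future_Suc
    by (rule expectation_joint_step_diff_le) (use Suc.IH[OF m(2), of "Suc k"] in \<open>simp del: prod.cl_ivl_Suc\<close>)
  also have "\<dots> = (\<Prod>l = k..k + Suc d. theta K g l)"
    by (simp add: prod.atLeast_Suc_atMost[of k "Suc (k + d)"] del: prod.cl_ivl_Suc)
  finally show ?case .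
qed

section \<open>Splitting the chain in time\<close>

lemma append_Cons_comp: "(@) (x # xs) = (#) x \<circ> (@) xs"
  by auto

text \<open>The Markov property at time \<open>k + m\<close>, whose state is
  \<open>last (s # l)\<close>; for \<open>m = 0\<close> this is \<open>s\<close> itself.\<close>

lemma future_add:
  fixes s :: "'a \<times> 'b"
  shows "future K g (m + m') k s =
   bind_pmf (future K g m k s) (\<lambda>l. map_pmf ((@) l) (future K g m' (k + m) (last (s # l))))"
proof (induction m arbitrary: k s)
  case 0
  have "(@) [] = (\<lambda>r :: ('a \<times> 'b) list. r)"
    by auto
  then show ?case by (simp add: bind_return_pmf pmf.map_ident)
next
  case (Suc m)
  then show ?case
    by (simp add: bind_assoc_pmf map_bind_pmf bind_map_pmf pmf.map_comp append_Cons_comp)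
qed

lemma joint_chain_add:
  "joint_chain p0 K g (m + m') =
   bind_pmf (joint_chain p0 K g m) (\<lambda>l. map_pmf ((@) l) (future K g m' (Suc m) (last l)))"
  by (simp add: joint_chain_def future_add bind_assoc_pmf map_bind_pmf bind_map_pmf
      pmf.map_comp append_Cons_comp)

lemma length_future: "l \<in> set_pmf (future K g m k s) \<Longrightarrow> length l = m"
  by (induction m arbitrary: k s l) auto

lemma length_joint_chain: "l \<in> set_pmf (joint_chain p0 K g m) \<Longrightarrow> length l = Suc m"
  by (auto simp: joint_chain_def dest: length_future)

section \<open>The adaptive Markov measure as a marginal of the joint chain\<close>

lemma pmf_bind_map_Cons:
  "pmf (bind_pmf p (\<lambda>t. map_pmf ((#) t) (F t))) (s # l) = pmf p s * pmf (F s) l"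
proof -
  \<comment> \<open>A list determines its head, so only the draw \<open>t = s\<close>
    contributes.\<close>
  have "pmf (map_pmf ((#) t) (F t)) (s # l) = indicator {s} t * pmf (F s) l" for t
  proof (cases "t = s")
    case True
    then show ?thesis by (simp add: pmf_map_inj')
  next
    case False
    then have "s # l \<notin> set_pmf (map_pmf ((#) t) (F t))" by auto
    with False show ?thesis by (simp add: pmf_eq_0_set_pmf)
  qed
  then show ?thesis
    by (simp add: pmf_bind measure_pmf_single)
qed

text \<open>Prepending \<open>s\<close> makes \<open>(s # l) ! i\<close> the state at time
  \<open>k + i\<close>, while \<open>l ! i\<close> is its successor.\<close>

lemma pmf_future:
  "pmf (future K g m k s) l =
   (if length l = m then \<Prod>i<m. pmf (joint_step K g (k + i) ((s # l) ! i)) (l ! i) else 0)"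
proof (induction m arbitrary: k s l)
  case 0
  then show ?case by (auto simp: pmf_return)
next
  case (Suc m)
  show ?case
  proof (cases l)
    case Nil
    then have "l \<notin> set_pmf (future K g (Suc m) k s)"
      by auto
    then have "pmf (future K g (Suc m) k s) l = 0"
      by (simp only: pmf_eq_0_set_pmf not_False_eq_True)
    with Nil show ?thesis by simp
  next
    case (Cons t r)
    then show ?thesis
      by (simp add: pmf_bind_map_Cons Suc prod.lessThan_Suc_shift del: prod.lessThan_Suc)
  qed
qed

lemma pmf_joint_chain:
  assumes "length l = Suc m"
  shows "pmf (joint_chain p0 K g m) l = path_weight (Suc m) p0 K g (map fst l) (map snd l)"
proof -
  obtain s r where l: "l = s # r" "length r = m"
    using assms by (cases l) auto
  have "(\<Prod>i<m. pmf (joint_step K g (1 + i) (l ! i)) (r ! i)) =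
    (\<Prod>i<m. pmf (joint_step K g (Suc i) (l ! i)) (l ! Suc i))"
    by (simp add: l)
  also have "\<dots> = (\<Prod>i = 1..<Suc m. pmf (joint_step K g i (l ! (i - 1))) (l ! i))"
    by (simp add: lessThan_atLeast0 prod.atLeast_Suc_lessThan_Suc_shift del: prod.op_ivl_Suc)
  also have "\<dots> = (\<Prod>i = 1..<Suc m.
      pmf (g i (map fst l ! (i - 1)) (map snd l ! (i - 1))) (map snd l ! i) *
      pmf (K (map snd l ! (i - 1)) (map fst l ! (i - 1))) (map fst l ! i))"
  proof (rule prod.cong)
    fix i assume "i \<in> {1..<Suc m}"
    with assms have "i < length l" "i - 1 < length l" by auto
    then show "pmf (joint_step K g i (l ! (i - 1))) (l ! i) =
      pmf (g i (map fst l ! (i - 1)) (map snd l ! (i - 1))) (map snd l ! i) *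
      pmf (K (map snd l ! (i - 1)) (map fst l ! (i - 1))) (map fst l ! i)"
      by (cases "l ! i") (simp add: joint_step_def pmf_pair)
  qed simp
  finally show ?thesis
    using l by (simp add: joint_chain_def pmf_bind_map_Cons pmf_future path_weight_def)
qed

text \<open>The joint paths over \<open>xs\<close> are the lists \<open>zip xs gs\<close>, so
  summing out the second coordinates gives the defining sum over parameter paths.\<close>

lemma adaptive_markov_eq_map_joint_chain:
  fixes p0 :: "('a::finite \<times> 'b::finite) pmf"
  shows "adaptive_markov (Suc m) p0 K g = map_pmf (map fst) (joint_chain p0 K g m)"
proof (rule pmf_eqI)
  fix xs :: "'a list"
  let ?J = "joint_chain p0 K g m"
  show "pmf (adaptive_markov (Suc m) p0 K g) xs = pmf (map_pmf (map fst) ?J) xs"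
  proof (cases "length xs = Suc m")
    case False
    then have "xs \<notin> set_pmf (map_pmf (map fst) ?J)"
      by (auto dest: length_joint_chain)
    then have "pmf (map_pmf (map fst) ?J) xs = 0"
      by (simp only: pmf_eq_0_set_pmf not_False_eq_True)
    with False show ?thesis
      by (simp add: pmf_adaptive_markov)
  next
    case True
    let ?L = "{l :: ('a \<times> 'b) list. map fst l = xs}"
    have "finite ?L"
      by (rule finite_subset[OF _ finite_lists_of_length[of "Suc m"]]) (use True in auto)
    then have "pmf (map_pmf (map fst) ?J) xs = (\<Sum>l\<in>?L. pmf ?J l)"
      by (simp add: pmf_map vimage_def measure_measure_pmf_finite)
    also have "\<dots> = (\<Sum>l\<in>?L. path_weight (Suc m) p0 K g xs (map snd l))"
      using True by (intro sum.cong) (auto simp: pmf_joint_chain)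
    also have "\<dots> = (\<Sum>gs | length gs = Suc m. path_weight (Suc m) p0 K g xs gs)"
      by (rule sum.reindex_bij_witness[of _ "zip xs" "map snd"])
         (use True in \<open>auto simp: zip_map_fst_snd\<close>)
    finally show ?thesis
      using True by (simp add: pmf_adaptive_markov)
  qed
qed

section \<open>Conditioning on the past\<close>

text \<open>Split the chain at time \<open>i\<close>: the past \<open>l\<close> decides the prefix
  event, and the tail event depends on the past only through \<open>last l\<close>.\<close>

lemma prob_adaptive_markov_prefix:
  fixes p0 :: "('a::finite \<times> 'b::finite) pmf" and K g
  assumes "1 \<le> i" "i < j" "j \<le> n"
  shows "measure_pmf.prob (adaptive_markov n p0 K g)
      (prefix_event i z \<inter> {x. drop (j - 1) x \<in> A}) =
    measure_pmf.expectation (joint_chain p0 K g (i - 1)) (\<lambda>l. indicator {l. map fst l = z} l *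
      measure_pmf.prob (future K g (n - i) i (last l)) {r. drop (j - 1 - i) (map fst r) \<in> A})"
proof -
  let ?E = "prefix_event i z \<inter> {x. drop (j - 1) x \<in> A}"
  \<comment> \<open>The past has index \<open>i - 1\<close> because
    \<open>joint_chain p0 K g m\<close> has \<open>m + 1\<close> states.\<close>
  have \<mu>: "adaptive_markov n p0 K g = map_pmf (map fst) (joint_chain p0 K g ((i - 1) + (n - i)))"
    using adaptive_markov_eq_map_joint_chain[of "(i - 1) + (n - i)" p0 K g] assms by simp
  have "measure_pmf.prob (adaptive_markov n p0 K g) ?E =
    measure_pmf.expectation (joint_chain p0 K g (i - 1)) (\<lambda>l.
      measure_pmf.prob (future K g (n - i) i (last l)) ((@) l -` map fst -` ?E))"
    using assms unfolding \<mu> joint_chain_add by (simp add: prob_bind_pmf)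
  also have "\<dots> = measure_pmf.expectation (joint_chain p0 K g (i - 1)) (\<lambda>l.
      indicator {l. map fst l = z} l *
      measure_pmf.prob (future K g (n - i) i (last l)) {r. drop (j - 1 - i) (map fst r) \<in> A})"
  proof (intro integral_cong_AE AE_pmfI)
    fix l assume "l \<in> set_pmf (joint_chain p0 K g (i - 1))"
    then have "length l = i"
      using assms by (auto dest: length_joint_chain)
    \<comment> \<open>As \<open>i < j\<close>, \<open>drop (j - 1)\<close> removes all of
      \<open>l\<close> and then \<open>j - 1 - i\<close> further states.\<close>
    then have "(@) l -` map fst -` ?E =
      (if map fst l = z then {r. drop (j - 1 - i) (map fst r) \<in> A} else {})"
      using assms by (auto simp: prefix_event_def)
    then show "measure_pmf.prob (future K g (n - i) i (last l)) ((@) l -` map fst -` ?E) =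
      indicator {l. map fst l = z} l *
      measure_pmf.prob (future K g (n - i) i (last l)) {r. drop (j - 1 - i) (map fst r) \<in> A}"
      by simp
  qed auto
  finally show ?thesis .
qed

lemma prob_cond_law:
  assumes "0 < measure_pmf.prob \<mu> (prefix_event i z)"
  shows "measure_pmf.prob (cond_law \<mu> i j z) A =
    measure_pmf.prob \<mu> (prefix_event i z \<inter> {x. drop (j - 1) x \<in> A}) /
    measure_pmf.prob \<mu> (prefix_event i z)"
proof -
  have "set_pmf \<mu> \<inter> prefix_event i z \<noteq> {}"
    using assms by (metis measure_pmf_zero_iff less_irrefl)
  then show ?thesis
    using assms
    by (simp add: cond_law_def cond_pmf.rep_eq measure_uniform_measure
        measure_pmf.emeasure_eq_measure vimage_def)
qed

text \<open>The conditional probability is a weighted average of the future probabilities over joint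
  pasts with first coordinates \<open>z\<close>, so it inherits any bounds uniform in the
  state.\<close>

lemma prob_cond_law_bounds:
  fixes p0 :: "('a::finite \<times> 'b::finite) pmf" and K g
  assumes ij: "1 \<le> i" "i < j" "j \<le> n"
    and pos: "0 < measure_pmf.prob (adaptive_markov n p0 K g) (prefix_event i z)"
    and h: "\<And>s. measure_pmf.prob (future K g (n - i) i s)
      {r. drop (j - 1 - i) (map fst r) \<in> A} \<in> {a..b}"
  shows "measure_pmf.prob (cond_law (adaptive_markov n p0 K g) i j z) A \<in> {a..b}"
proof -
  let ?J = "joint_chain p0 K g (i - 1)" and ?\<mu> = "adaptive_markov n p0 K g"
  let ?h = "\<lambda>s. measure_pmf.prob (future K g (n - i) i s) {r. drop (j - 1 - i) (map fst r) \<in> A}"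
  let ?I = "indicator {l. map fst l = z} :: _ \<Rightarrow> real"
  have "finite (set_pmf ?J)"
    by (rule finite_subset[OF _ finite_lists_of_length[of "Suc (i - 1)"]])
       (auto dest: length_joint_chain)
  then have int: "integrable ?J f" for f :: "_ \<Rightarrow> real"
    by (rule integrable_measure_pmf_finite)
  \<comment> \<open>Taking the tail event to be \<open>UNIV\<close> gives the normalising
    constant.\<close>
  have E: "measure_pmf.prob ?\<mu> (prefix_event i z) = measure_pmf.expectation ?J ?I"
    using prob_adaptive_markov_prefix[OF ij, of p0 K g z UNIV] by simp
  have "measure_pmf.expectation ?J (\<lambda>l. a * ?I l) \<le>
      measure_pmf.expectation ?J (\<lambda>l. ?I l * ?h (last l))"
    by (intro integral_mono int) (use h in \<open>auto simp: indicator_def\<close>)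
  moreover have "measure_pmf.expectation ?J (\<lambda>l. ?I l * ?h (last l)) \<le>
      measure_pmf.expectation ?J (\<lambda>l. b * ?I l)"
    by (intro integral_mono int) (use h in \<open>auto simp: indicator_def\<close>)
  ultimately show ?thesis
    using pos E unfolding prob_cond_law[OF pos] prob_adaptive_markov_prefix[OF ij]
    by (simp add: pos_le_divide_eq pos_divide_le_eq)
qed

section \<open>The bound on the mixing coefficients\<close>

lemma tv_diff_cond_law_le:
  fixes p0 :: "('a::finite \<times> 'b::finite) pmf" and K g n
  defines "\<mu> \<equiv> adaptive_markov n p0 K g"
  assumes ij: "1 \<le> i" "i < j" "j \<le> n"
    and pos: "0 < measure_pmf.prob \<mu> (prefix_event i z)"
      "0 < measure_pmf.prob \<mu> (prefix_event i z')"
  shows "tv_diff (cond_law \<mu> i j z) (cond_law \<mu> i j z') \<le> (\<Prod>k = i..<j. theta K g k)"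
proof (rule tv_diff_le)
  fix A
  let ?h = "\<lambda>s. measure_pmf.prob (future K g (n - i) i s) {r. drop (j - 1 - i) (map fst r) \<in> A}"
  let ?D = "\<Prod>k = i..<j. theta K g k"
  \<comment> \<open>Both conditional probabilities will lie in the interval of length
    \<open>?D\<close> starting at this minimum.\<close>
  define a where "a = Min (range ?h)"
  have "{i..i + (j - 1 - i)} = {i..<j}"
    using ij by auto
  then have osc: "?h s - ?h t \<le> ?D" for s t
    using future_event_oscillation[of "j - 1 - i" "n - i" K g i s A t] ij by simp
  have "a \<in> range ?h"
    unfolding a_def by (intro Min_in) auto
  then obtain t where t: "a = ?h t" by auto
  have "a \<le> ?h s" for s
    unfolding a_def by (rule Min_le) auto
  then have "?h s \<in> {a..a + ?D}" for s
    using osc[of s t] t by simp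
  then have "measure_pmf.prob (cond_law \<mu> i j z) A \<in> {a..a + ?D}"
    "measure_pmf.prob (cond_law \<mu> i j z') A \<in> {a..a + ?D}"
    using pos unfolding \<mu>_def by (intro prob_cond_law_bounds[OF ij]; simp)+
  then show "\<bar>measure_pmf.prob (cond_law \<mu> i j z) A
    - measure_pmf.prob (cond_law \<mu> i j z') A\<bar> \<le> ?D"
    by auto
qed

theorem theorem5p3:
  fixes p0 :: "('a::finite \<times> 'b::finite) pmf"
    and K :: "'b \<Rightarrow> 'a \<Rightarrow> 'a pmf"
    and g :: "nat \<Rightarrow> 'a \<Rightarrow> 'b \<Rightarrow> 'b pmf"
    and n i j :: nat
  assumes "n \<ge> 2"
    and "1 \<le> i" and "i < j" and "j \<le> n"
  shows "eta_bar (adaptive_markov n p0 K g) i j \<le> (\<Prod>k = i..<j. theta K g k)"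
proof -
  let ?\<mu> = "adaptive_markov n p0 K g"
  let ?pos = "\<lambda>z. 0 < measure_pmf.prob ?\<mu> (prefix_event i z)"
  let ?S = "{tv_diff (cond_law ?\<mu> i j (y @ [w])) (cond_law ?\<mu> i j (y @ [w'])) | y w w'.
    length y = i - 1 \<and> ?pos (y @ [w]) \<and> ?pos (y @ [w'])}"
  have "?S \<subseteq> (\<lambda>(y, w, w'). tv_diff (cond_law ?\<mu> i j (y @ [w])) (cond_law ?\<mu> i j (y @ [w'])))
    ` ({y. length y = i - 1} \<times> UNIV \<times> UNIV)"
    by (auto simp: image_iff) blast
  then have "finite ?S"
    by (rule finite_subset) (intro finite_imageI finite_cartesian_product finite_lists_of_length finite)
  \<comment> \<open>Truncating any point of the support to length \<open>i\<close> yields an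
    admissible pair with \<open>w = w'\<close>.\<close>
  moreover have "?S \<noteq> {}"
  proof -
    obtain x where x: "x \<in> set_pmf ?\<mu>"
      using set_pmf_not_empty[of ?\<mu>] by blast
    then have "length x = n"
      using assms by (auto simp: set_pmf_iff pmf_adaptive_markov split: if_splits)
    then have "take i x \<noteq> []" "length (butlast (take i x)) = i - 1"
      using assms by auto
    moreover have "?pos (take i x)"
      using x by (intro measure_pmf_posI[of x]) (auto simp: prefix_event_def)
    ultimately show ?thesis
      by (smt (verit) append_butlast_last_id empty_iff mem_Collect_eq)
  qed
  moreover have "v \<le> (\<Prod>k = i..<j. theta K g k)" if "v \<in> ?S" for v
    using that tv_diff_cond_law_le[OF assms(2-4)] by blast
  ultimately show ?thesis
    unfolding eta_bar_def by (intro Max.boundedI)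
qed

end
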